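(* Let $G$ be a disconnected pseudograph with connected components $G_1, G_2, \ldots, G_k$. Then $\mathcal{K}G$ is isomorphic to $\mathcal{K}G_1 \times \mathcal{K}G_2 \times \cdots \times \mathcal{K}G_k \times \Delta_{k-1}$, where $\Delta_{k-1}$ is the $(k-1)$-simplex.
   Context: A pseudograph is a finite graph in which loops and multiple edges are allowed; it need not be connected. For a pseudograph $H$ with connected components $H_1,\dots,H_m$: a tube of $H$ is a proper connected subgraph $t$ of $H$ such that whenever two nodes of $t$ are joined by at least one edge of $H$, $t$ contains at least one edge joining them; two tubes are compatible if one properly contains the other, or if they are disjoint and cannot be connected by a single edge of $H$; a tubing of $H$ is a set of pairwise compatible tubes which does not contain all of $H_1,\ldots,H_m$. The pseudograph associahedron $\mathcal{K}H$ is the simple polytope (or polytopal cone, if $H$ has loops) whose face poset is isomorphic to the poset of tubings of $H$ ordered by reverse inclusion (a tubing with $j$ tubes corresponding to a face of codimension $j$). "Isomorphic" means having isomorphic face posets; the face poset of a product is the product of face posets. *)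

theory Defs
  imports "HOL-Analysis.Analysis"
begin

section \<open>Pseudographs\<close>

text \<open>An edge \<open>e\<close> joins the nodes in \<open>pends H e\<close>: two nodes, or a single one if \<open>e\<close> is a loop.
  Distinct edges may have the same ends.\<close>

record ('v, 'e) pgraph =
  pnodes :: "'v set"
  pedges :: "'e set"
  pends :: "'e \<Rightarrow> 'v set"

definition pseudograph :: "('v, 'e) pgraph \<Rightarrow> bool" where
  "pseudograph H \<longleftrightarrow> finite (pnodes H) \<and> finite (pedges H) \<and>
     (\<forall>e\<in>pedges H. pends H e \<subseteq> pnodes H \<and> card (pends H e) \<in> {1, 2})"

definition has_loop :: "('v, 'e) pgraph \<Rightarrow> bool" where
  "has_loop H \<longleftrightarrow> (\<exists>e\<in>pedges H. \<exists>v. pends H e = {v})"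

definition joined :: "('v, 'e) pgraph \<Rightarrow> 'v \<Rightarrow> 'v \<Rightarrow> bool" where
  "joined H u v \<longleftrightarrow> (\<exists>e\<in>pedges H. pends H e = {u, v})"

text \<open>The condition \<open>pends t = pends H\<close> makes two subgraphs of \<open>H\<close> equal as soon as they have the
  same nodes and the same edges.\<close>

definition subgraph :: "('v, 'e) pgraph \<Rightarrow> ('v, 'e) pgraph \<Rightarrow> bool" where
  "subgraph t H \<longleftrightarrow> pseudograph t \<and> pseudograph H \<and>
     pnodes t \<subseteq> pnodes H \<and> pedges t \<subseteq> pedges H \<and> pends t = pends H"

definition connected_pgraph :: "('v, 'e) pgraph \<Rightarrow> bool" where
  "connected_pgraph H \<longleftrightarrow> pnodes H \<noteq> {} \<and>
     (\<forall>u\<in>pnodes H. \<forall>v\<in>pnodes H. (joined H)\<^sup>*\<^sup>* u v)"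

definition pcomponents :: "('v, 'e) pgraph \<Rightarrow> ('v, 'e) pgraph set" where
  "pcomponents H = {C. subgraph C H \<and> connected_pgraph C \<and>
     (\<forall>D. subgraph D H \<and> connected_pgraph D \<and> subgraph C D \<longrightarrow> D = C)}"

section \<open>Tubes and tubings\<close>

text \<open>The two nodes are distinct: a tube need not contain any of the loops at its nodes.\<close>

definition tube :: "('v, 'e) pgraph \<Rightarrow> ('v, 'e) pgraph \<Rightarrow> bool" where
  "tube H t \<longleftrightarrow> subgraph t H \<and> t \<noteq> H \<and> connected_pgraph t \<and>
     (\<forall>u\<in>pnodes t. \<forall>v\<in>pnodes t. u \<noteq> v \<longrightarrow> joined H u v \<longrightarrow> joined t u v)"

definition compatible :: "('v, 'e) pgraph \<Rightarrow> ('v, 'e) pgraph \<Rightarrow> ('v, 'e) pgraph \<Rightarrow> bool" where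
  "compatible H s t \<longleftrightarrow>
     (subgraph s t \<and> s \<noteq> t) \<or> (subgraph t s \<and> t \<noteq> s) \<or>
     (pnodes s \<inter> pnodes t = {} \<and> \<not> (\<exists>u\<in>pnodes s. \<exists>v\<in>pnodes t. joined H u v))"

definition tubings :: "('v, 'e) pgraph \<Rightarrow> ('v, 'e) pgraph set set" where
  "tubings H = {T. (\<forall>t\<in>T. tube H t) \<and> pairwise (compatible H) T \<and> \<not> pcomponents H \<subseteq> T}"

section \<open>Face posets and pseudograph associahedra\<close>

text \<open>The empty face is left out: only then is the face poset of a product the product of the face
  posets, and only then does the face poset correspond to the poset of tubings.\<close>

definition faces :: "'a::euclidean_space set \<Rightarrow> 'a set set" where
  "faces P = {F. F face_of P \<and> F \<noteq> {}}"

definition combinatorially_isomorphic ::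
    "'a::euclidean_space set \<Rightarrow> 'b::euclidean_space set \<Rightarrow> bool" where
  "combinatorially_isomorphic P Q \<longleftrightarrow>
     (\<exists>f. bij_betw f (faces P) (faces Q) \<and>
          (\<forall>E\<in>faces P. \<forall>F\<in>faces P. E \<subseteq> F \<longleftrightarrow> f E \<subseteq> f F))"

definition simple_polyhedron :: "'a::euclidean_space set \<Rightarrow> bool" where
  "simple_polyhedron P \<longleftrightarrow> polyhedron P \<and> (\<exists>v. v extreme_point_of P) \<and>
     (\<forall>v. v extreme_point_of P \<longrightarrow> int (card {F. F facet_of P \<and> v \<in> F}) = aff_dim P)"

text \<open>A \<open>polytopal cone\<close> is a possibly unbounded pointed polyhedron; it may have several vertices,
  so it is not a cone in the sense of \<^const>\<open>cone\<close>.  The polytope is only determined up to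
  combinatorial isomorphism, hence a predicate on \<open>P\<close> rather than a function of \<open>H\<close>.\<close>

definition pseudograph_associahedron ::
    "('v, 'e) pgraph \<Rightarrow> 'a::euclidean_space set \<Rightarrow> bool" where
  "pseudograph_associahedron H P \<longleftrightarrow>
     simple_polyhedron P \<and> (\<not> has_loop H \<longrightarrow> polytope P) \<and>
     (\<exists>f. bij_betw f (tubings H) (faces P) \<and>
          (\<forall>S\<in>tubings H. \<forall>T\<in>tubings H. T \<subseteq> S \<longleftrightarrow> f S \<subseteq> f T) \<and>
          (\<forall>T\<in>tubings H. aff_dim (f T) = aff_dim P - int (card T)))"

end

theory Submission
  imports Defs
begin

text \<open>A tube of \<open>G\<close> is either a whole component or a tube of exactly one component, tubes in different
  components are compatible, and a component is compatible with each of its own tubes.  A tubing of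
  \<open>G\<close> is therefore a free choice of a tubing of every component together with a set of components,
  not all of them.  The components that are left out form a nonempty subset of the \<open>k\<close> vertices of
  the simplex, that is, a nonempty face of it.\<close>

section \<open>Faces of products indexed by a finite type\<close>

text \<open>A segment through a point of the product projects in each coordinate either to a single
  point or to a segment with the projected point in its interior, so the face condition can be
  tested one coordinate at a time.\<close>

lemma face_of_vec_prod:
  fixes Q E :: "'k::finite \<Rightarrow> 'b::euclidean_space set"
  assumes "\<And>i. E i face_of Q i"
  shows "{x :: 'b ^ 'k. \<forall>i. x $ i \<in> E i} face_of {x. \<forall>i. x $ i \<in> Q i}"
  unfolding face_of_def
proof (intro conjI ballI impI)
  show "{x :: 'b ^ 'k. \<forall>i. x $ i \<in> E i} \<subseteq> {x. \<forall>i. x $ i \<in> Q i}"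
    using assms face_of_imp_subset by blast
  have "convex (E i)" for i
    using assms by (rule face_of_imp_convex)
  then show "convex {x :: 'b ^ 'k. \<forall>i. x $ i \<in> E i}"
    by (simp add: convex_def)
  fix a b x :: "'b ^ 'k"
  assume a: "a \<in> {x. \<forall>i. x $ i \<in> Q i}" and b: "b \<in> {x. \<forall>i. x $ i \<in> Q i}"
    and x: "x \<in> {x. \<forall>i. x $ i \<in> E i}" and seg: "x \<in> open_segment a b"
  from seg obtain u where u: "0 < u" "u < 1" "x = (1 - u) *\<^sub>R a + u *\<^sub>R b"
    by (auto simp: in_segment)
  have "a $ i \<in> E i \<and> b $ i \<in> E i" for i
  proof (cases "a $ i = b $ i")
    case True
    have "x $ i = (1 - u) *\<^sub>R a $ i + u *\<^sub>R b $ i"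
      using u(3) by simp
    with True have "x $ i = a $ i"
      by (simp flip: scaleR_left_distrib)
    then show ?thesis
      using x True by (metis mem_Collect_eq)
  next
    case False
    then have "x $ i \<in> open_segment (a $ i) (b $ i)"
      using u by (auto simp: in_segment)
    then show ?thesis
      using assms[of i] a b x unfolding face_of_def by blast
  qed
  then show "a \<in> {x. \<forall>i. x $ i \<in> E i}" "b \<in> {x. \<forall>i. x $ i \<in> E i}"
    by auto
qed

text \<open>Freezing all coordinates but one lifts a segment of \<open>Q i\<close> to a segment of
  the product, so the projections of \<open>F\<close> inherit the face condition. Exchanging a
  single coordinate between two points of \<open>F\<close> does not leave \<open>F\<close>, so
  coordinates can be mixed freely.\<close>

lemma face_of_vec_prod_imp_prod:
  fixes Q :: "'k::finite \<Rightarrow> 'b::euclidean_space set" and F :: "('b ^ 'k) set"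
  assumes F: "F face_of {x. \<forall>i. x $ i \<in> Q i}"
  shows "(\<lambda>x. x $ i) ` F face_of Q i"
    and "F = {x. \<forall>i. x $ i \<in> (\<lambda>y. y $ i) ` F}"
proof -
  let ?P = "{x :: 'b ^ 'k. \<forall>i. x $ i \<in> Q i}"
  define upd where "upd x i a = (\<chi> j. if j = i then a else x $ j)" for x :: "'b ^ 'k" and i a
  have upd_nth: "upd x i a $ j = (if j = i then a else x $ j)" for x i a j
    by (simp add: upd_def)
  have sub: "F \<subseteq> ?P" and cvx: "convex F"
    and ext: "\<And>a b x. a \<in> ?P \<Longrightarrow> b \<in> ?P \<Longrightarrow> x \<in> F \<Longrightarrow> x \<in> open_segment a b \<Longrightarrow> a \<in> F \<and> b \<in> F"
    using F unfolding face_of_def by blast+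
  show "(\<lambda>x. x $ i) ` F face_of Q i"
    unfolding face_of_def
  proof (intro conjI ballI impI)
    show "(\<lambda>x. x $ i) ` F \<subseteq> Q i"
      using sub by auto
    show "convex ((\<lambda>x. x $ i) ` F)"
      using cvx by (intro convex_linear_image) (auto intro: bounded_linear.linear)
    fix a b z
    assume ab: "a \<in> Q i" "b \<in> Q i" and z: "z \<in> (\<lambda>x. x $ i) ` F" "z \<in> open_segment a b"
    from z obtain x where x: "x \<in> F" "z = x $ i"
      by auto
    from z obtain u where u: "a \<noteq> b" "0 < u" "u < 1" "z = (1 - u) *\<^sub>R a + u *\<^sub>R b"
      by (auto simp: in_segment)
    have "upd x i a \<in> ?P" "upd x i b \<in> ?P"
      using x sub ab by (auto simp: upd_nth)
    moreover have "x = (1 - u) *\<^sub>R upd x i a + u *\<^sub>R upd x i b"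
      using x u by (simp add: vec_eq_iff upd_nth algebra_simps)
    moreover have "upd x i a \<noteq> upd x i b"
      using u(1) upd_nth by metis
    ultimately have "upd x i a \<in> F \<and> upd x i b \<in> F"
      using u x by (intro ext[of _ _ x]) (auto simp: in_segment)
    then show "a \<in> (\<lambda>x. x $ i) ` F" "b \<in> (\<lambda>x. x $ i) ` F"
      by (metis image_eqI upd_nth)+
  qed
  \<comment> \<open>The midpoint of \<open>y\<close> and \<open>w\<close> is also the midpoint of the points obtained by swapping their
    \<open>i\<close>-th coordinates.\<close>
  have swap: "upd y i (w $ i) \<in> F" if y: "y \<in> F" and w: "w \<in> F" for y w i
  proof -
    define m where "m = (1/2::real) *\<^sub>R y + (1/2::real) *\<^sub>R w"
    have m: "m \<in> F"
      unfolding m_def using cvx y w by (intro convexD) auto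
    have m': "m = (1 - 1/2) *\<^sub>R upd y i (w $ i) + (1/2) *\<^sub>R upd w i (y $ i)"
      unfolding m_def by (simp add: vec_eq_iff upd_nth algebra_simps)
    have P: "upd y i (w $ i) \<in> ?P" "upd w i (y $ i) \<in> ?P"
      using y w sub by (auto simp: upd_nth)
    show ?thesis
    proof (cases "upd y i (w $ i) = upd w i (y $ i)")
      case True
      then have "m = upd y i (w $ i)"
        using m' by (simp flip: scaleR_left_distrib)
      then show ?thesis
        using m by simp
    next
      case False
      then have "m \<in> open_segment (upd y i (w $ i)) (upd w i (y $ i))"
        using m' by (auto simp: in_segment intro!: exI[of _ "1/2"])
      then show ?thesis
        using ext P m by blast
    qed
  qed
  have "x \<in> F" if x: "\<forall>i. x $ i \<in> (\<lambda>y. y $ i) ` F" for x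
  proof -
    \<comment> \<open>\<open>A\<close> collects coordinates in which some point of \<open>F\<close>
      already agrees with \<open>x\<close>; each swap adds one, and finitely many swaps reach them
      all.\<close>
    have "\<exists>y\<in>F. \<forall>j\<in>A. y $ j = x $ j" for A :: "'k set"
      using finite[of A]
    proof (induction A rule: finite_induct)
      case empty
      show ?case
        using x by blast
    next
      case (insert i A)
      then obtain y where y: "y \<in> F" "\<forall>j\<in>A. y $ j = x $ j"
        by blast
      from x obtain w where w: "w \<in> F" "x $ i = w $ i"
        by blast
      show ?case
        using swap[OF y(1) w(1), of i] y w by (intro bexI) (auto simp: upd_nth)
    qed
    from this[of UNIV] show ?thesis
      by (metis UNIV_I vec_eq_iff)
  qed
  then show "F = {x. \<forall>i. x $ i \<in> (\<lambda>y. y $ i) ` F}"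
    by blast
qed

text \<open>Nonempty factors let a point of \<open>E i\<close> be completed to a point of the whole
  product; an empty factor would make the inclusion of products vacuous.\<close>

lemma vec_prod_subset_iff:
  fixes E E' :: "'k::finite \<Rightarrow> 'b set"
  assumes "\<And>i. E i \<noteq> {}"
  shows "{x :: 'b ^ 'k. \<forall>i. x $ i \<in> E i} \<subseteq> {x. \<forall>i. x $ i \<in> E' i} \<longleftrightarrow> (\<forall>i. E i \<subseteq> E' i)"
proof
  assume L: "{x :: 'b ^ 'k. \<forall>i. x $ i \<in> E i} \<subseteq> {x. \<forall>i. x $ i \<in> E' i}"
  show "\<forall>i. E i \<subseteq> E' i"
  proof (intro allI subsetI)
    fix i a
    assume a: "a \<in> E i"
    from assms have "\<forall>j. \<exists>y. y \<in> E j"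
      by blast
    then obtain e where e: "\<And>j. e j \<in> E j"
      by metis
    have "(\<chi> j. if j = i then a else e j) \<in> {x :: 'b ^ 'k. \<forall>i. x $ i \<in> E i}"
      using a e by simp
    with L have "(\<chi> j. if j = i then a else e j) \<in> {x :: 'b ^ 'k. \<forall>i. x $ i \<in> E' i}"
      by (rule subsetD)
    then have "(\<chi> j. if j = i then a else e j) $ i \<in> E' i"
      by blast
    then show "a \<in> E' i"
      by simp
  qed
qed blast

lemma vec_prod_nonempty:
  fixes E :: "'k::finite \<Rightarrow> 'b set"
  assumes "\<And>i. E i \<noteq> {}"
  shows "{x :: 'b ^ 'k. \<forall>i. x $ i \<in> E i} \<noteq> {}"
proof -
  from assms have "\<forall>j. \<exists>y. y \<in> E j"
    by blast
  then obtain e where "\<And>j. e j \<in> E j"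
    by metis
  then have "(\<chi> j. e j) \<in> {x :: 'b ^ 'k. \<forall>i. x $ i \<in> E i}"
    by simp
  then show ?thesis
    by blast
qed

text \<open>Each point of \<open>K\<close> is extreme in \<open>convex hull K\<close>, hence in
  every smaller hull that contains it, and the extreme points of \<open>convex hull B\<close> lie in
  \<open>B\<close>. This compares faces of a simplex through their vertex sets.\<close>

lemma convex_hull_subset_iff_affine_independent:
  fixes K :: "'a::euclidean_space set"
  assumes K: "\<not> affine_dependent K" and "A \<subseteq> K" "B \<subseteq> K"
  shows "convex hull A \<subseteq> convex hull B \<longleftrightarrow> A \<subseteq> B"
proof
  assume L: "convex hull A \<subseteq> convex hull B"
  show "A \<subseteq> B"
  proof
    fix x
    assume x: "x \<in> A"
    then have "x \<in> convex hull B"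
      using L hull_inc by fastforce
    moreover have "x extreme_point_of (convex hull K)"
      using extreme_point_of_convex_hull_affine_independent[OF K] x \<open>A \<subseteq> K\<close> by blast
    ultimately have "x extreme_point_of (convex hull B)"
      using hull_mono[OF \<open>B \<subseteq> K\<close>, of convex] by (auto simp: extreme_point_of_def)
    then show "x \<in> B"
      by (rule extreme_point_of_convex_hull)
  qed
qed (rule hull_mono)

section \<open>Subgraphs and components\<close>

lemma subgraph_refl: "pseudograph H \<Longrightarrow> subgraph H H"
  by (simp add: subgraph_def)

lemma subgraph_trans: "subgraph s t \<Longrightarrow> subgraph t H \<Longrightarrow> subgraph s H"
  unfolding subgraph_def by auto

lemma subgraph_antisym: "subgraph s t \<Longrightarrow> subgraph t s \<Longrightarrow> s = t"
  unfolding subgraph_def by (intro pgraph.equality) auto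

lemma joined_mono: "subgraph s t \<Longrightarrow> joined s u v \<Longrightarrow> joined t u v"
  unfolding subgraph_def joined_def by auto

lemma joined_sym: "joined H u v \<Longrightarrow> joined H v u"
  unfolding joined_def by (simp add: insert_commute)

text \<open>A proper subgraph lacks a node or an edge, so the total number of both is a measure by
  which a largest choice is a maximal one.\<close>

lemma subgraph_eq_if_card_le:
  assumes st: "subgraph s t"
    and "card (pnodes t) + card (pedges t) \<le> card (pnodes s) + card (pedges s)"
  shows "s = t"
proof -
  have fin: "finite (pnodes t)" "finite (pedges t)"
    and sub: "pnodes s \<subseteq> pnodes t" "pedges s \<subseteq> pedges t" and ends: "pends s = pends t"
    using st by (auto simp: subgraph_def pseudograph_def)
  have "card (pnodes s) \<le> card (pnodes t)" "card (pedges s) \<le> card (pedges t)"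
    using fin sub by (auto intro: card_mono)
  with assms(2) have "card (pnodes t) \<le> card (pnodes s)" "card (pedges t) \<le> card (pedges s)"
    by linarith+
  then have "pnodes s = pnodes t" "pedges s = pedges t"
    using card_seteq fin sub by blast+
  then show ?thesis
    using ends by (intro pgraph.equality) auto
qed

text \<open>The union serves as \<open>r\<close>: its nodes reach one another through a common node
  of \<open>s\<close> and \<open>t\<close>.\<close>

lemma connected_Un_subgraph:
  assumes s: "subgraph s H" "connected_pgraph s" and t: "subgraph t H" "connected_pgraph t"
    and meet: "pnodes s \<inter> pnodes t \<noteq> {}"
  obtains r where "subgraph r H" "connected_pgraph r" "subgraph s r" "subgraph t r"
proof -
  define r where "r = \<lparr>pnodes = pnodes s \<union> pnodes t, pedges = pedges s \<union> pedges t, pends = pends H\<rparr>"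
  have "pseudograph r"
    using s(1) t(1) unfolding r_def subgraph_def pseudograph_def
    by (simp add: ball_Un) (metis le_supI1 le_supI2)
  then have sub: "subgraph r H" "subgraph s r" "subgraph t r"
    using s(1) t(1) by (simp_all add: r_def subgraph_def)
  obtain w where w: "w \<in> pnodes s" "w \<in> pnodes t"
    using meet by blast
  have reach: "(joined r)\<^sup>*\<^sup>* u v" if "u \<in> pnodes s \<and> v \<in> pnodes s \<or> u \<in> pnodes t \<and> v \<in> pnodes t" for u v
  proof -
    have "(joined s)\<^sup>*\<^sup>* u v \<or> (joined t)\<^sup>*\<^sup>* u v"
      using that s(2) t(2) by (auto simp: connected_pgraph_def)
    moreover have "joined s \<le> joined r" "joined t \<le> joined r"
      using joined_mono[OF sub(2)] joined_mono[OF sub(3)] by blast+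
    ultimately show ?thesis
      by (meson predicate2D rtranclp_mono)
  qed
  have "(joined r)\<^sup>*\<^sup>* u w \<and> (joined r)\<^sup>*\<^sup>* w u" if "u \<in> pnodes r" for u
    using that w reach by (auto simp: r_def)
  moreover have "pnodes r \<noteq> {}"
    using w by (auto simp: r_def)
  ultimately have "connected_pgraph r"
    unfolding connected_pgraph_def by (meson rtranclp_trans)
  with sub that show ?thesis
    by blast
qed

text \<open>By maximality of \<open>C\<close>, a connected subgraph containing both \<open>C\<close>
  and \<open>t\<close> is \<open>C\<close> itself.\<close>

lemma pcomponents_absorb:
  assumes C: "C \<in> pcomponents G" and t: "subgraph t G" "connected_pgraph t"
    and meet: "pnodes t \<inter> pnodes C \<noteq> {}"
  shows "subgraph t C"
proof -
  have C': "subgraph C G" "connected_pgraph C"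
    using C by (auto simp: pcomponents_def)
  obtain r where "subgraph r G" "connected_pgraph r" "subgraph t r" "subgraph C r"
    using connected_Un_subgraph[OF t C' meet] .
  then show ?thesis
    using C by (auto simp: pcomponents_def)
qed

text \<open>\<open>G\<close> is finite, so some connected subgraph containing \<open>t\<close> has
  the largest number of nodes and edges, and that one is maximal.\<close>

lemma ex_pcomponent_supergraph:
  assumes t: "subgraph t G" "connected_pgraph t"
  shows "\<exists>C\<in>pcomponents G. subgraph t C"
proof -
  let ?P = "\<lambda>D. subgraph D G \<and> connected_pgraph D \<and> subgraph t D"
  let ?size = "\<lambda>D :: ('a, 'b) pgraph. card (pnodes D) + card (pedges D)"
  have "?P t"
    using t by (auto simp: subgraph_def)
  moreover have "\<forall>D. ?P D \<longrightarrow> ?size D < Suc (?size G)"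
    by (auto simp: subgraph_def pseudograph_def less_Suc_eq_le intro!: add_mono card_mono)
  ultimately obtain D where D: "?P D" and max: "\<And>E. ?P E \<Longrightarrow> ?size E \<le> ?size D"
    using ex_has_greatest_nat[of ?P t ?size] by blast
  have "E = D" if "subgraph E G" "connected_pgraph E" "subgraph D E" for E
    using that D max[of E] subgraph_trans subgraph_eq_if_card_le[of D E] by blast
  with D show ?thesis
    by (auto simp: pcomponents_def)
qed

lemma pcomponents_disjoint:
  assumes "C \<in> pcomponents G" "D \<in> pcomponents G" "pnodes C \<inter> pnodes D \<noteq> {}"
  shows "C = D"
proof (rule subgraph_antisym)
  show "subgraph C D" "subgraph D C"
    using assms by (auto intro!: pcomponents_absorb[of _ G] simp: pcomponents_def Int_commute)
qed

text \<open>An edge together with its ends is a connected subgraph; meeting \<open>C\<close> in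
  \<open>u\<close>, it is absorbed by \<open>C\<close>.\<close>

lemma joined_pcomponent:
  assumes C: "C \<in> pcomponents G" and u: "u \<in> pnodes C" and uv: "joined G u v"
  shows "joined C u v"
proof -
  have G: "pseudograph G" "pnodes C \<subseteq> pnodes G"
    using C by (auto simp: pcomponents_def subgraph_def)
  obtain e where e: "e \<in> pedges G" "pends G e = {u, v}"
    using uv by (auto simp: joined_def)
  define t where "t = \<lparr>pnodes = {u, v}, pedges = {e}, pends = pends G\<rparr>"
  have t: "subgraph t G"
    using G e by (auto simp: t_def subgraph_def pseudograph_def card_insert_if)
  have j: "joined t u v"
    using e by (auto simp: t_def joined_def)
  then have "connected_pgraph t"
    using joined_sym[OF j] by (auto simp: connected_pgraph_def t_def)
  moreover have "pnodes t \<inter> pnodes C \<noteq> {}"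
    using u by (auto simp: t_def)
  ultimately show ?thesis
    using joined_mono[OF pcomponents_absorb[OF C t] j] by blast
qed

section \<open>Tubes and tubings of a disconnected pseudograph\<close>

lemma tube_nodes_nonempty: "tube H t \<Longrightarrow> pnodes t \<noteq> {}"
  by (simp add: tube_def connected_pgraph_def)

lemma not_tube_self: "\<not> tube H H"
  by (simp add: tube_def)

lemma tube_pcomponentI:
  assumes C: "C \<in> pcomponents G" and t: "tube G t" "subgraph t C" "t \<noteq> C"
  shows "tube C t"
proof -
  have "joined C u v \<Longrightarrow> joined G u v" for u v
    using C joined_mono[of C G] unfolding pcomponents_def by blast
  then show ?thesis
    using t unfolding tube_def by blast
qed

text \<open>\<open>C\<close> contains an edge between any two nodes joined in \<open>G\<close> as
  soon as one of them is in \<open>C\<close>, so the edge condition carries over. If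
  \<open>t\<close> were \<open>G\<close>, then \<open>C\<close> would lie between \<open>t\<close>
  and \<open>G\<close> and equal \<open>t\<close>.\<close>

lemma tube_of_pcomponent:
  assumes C: "C \<in> pcomponents G" and t: "tube C t"
  shows "tube G t"
proof -
  have CG: "subgraph C G" and sub: "subgraph t C"
    using C t by (auto simp: pcomponents_def tube_def)
  have "t \<noteq> G"
    using subgraph_antisym[OF CG] sub t by (auto simp: tube_def)
  moreover have "joined C u v" if "u \<in> pnodes t" "joined G u v" for u v
    using that joined_pcomponent[OF C] sub by (auto simp: subgraph_def)
  ultimately show ?thesis
    using t subgraph_trans[OF sub CG] by (auto simp: tube_def)
qed

text \<open>Properness comes from connectedness: \<open>C\<close> is connected and \<open>G\<close>
  is not.\<close>

lemma tube_pcomponent: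
  assumes "C \<in> pcomponents G" "\<not> connected_pgraph G"
  shows "tube G C"
  using assms joined_pcomponent[OF assms(1)] unfolding tube_def pcomponents_def by blast

text \<open>A connected \<open>H\<close> is a component of itself, and tubes are proper, so a set of
  tubes never contains all components.\<close>

lemma tubings_connected:
  assumes "pseudograph H" "connected_pgraph H"
  shows "tubings H = {T. (\<forall>t\<in>T. tube H t) \<and> pairwise (compatible H) T}"
proof -
  have "H \<in> pcomponents H"
    using assms subgraph_antisym by (auto simp: pcomponents_def subgraph_refl)
  then show ?thesis
    using not_tube_self by (auto simp: tubings_def)
qed

lemma compatible_pcomponent:
  assumes "C \<in> pcomponents G" "pnodes s \<subseteq> pnodes C"
  shows "compatible C s t \<longleftrightarrow> compatible G s t"
proof -
  have "joined C u v \<longleftrightarrow> joined G u v" if "u \<in> pnodes s" for u v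
    using that assms joined_pcomponent[OF assms(1)] joined_mono[of C G]
    unfolding pcomponents_def by blast
  then show ?thesis
    unfolding compatible_def by blast
qed

text \<open>An edge with one end in \<open>C\<close> has both ends in \<open>C\<close>, so it cannot
  reach the disjoint component \<open>D\<close>.\<close>

lemma compatible_pcomponents:
  assumes C: "C \<in> pcomponents G" "D \<in> pcomponents G" "C \<noteq> D"
    and st: "pnodes s \<subseteq> pnodes C" "pnodes t \<subseteq> pnodes D"
  shows "compatible G s t"
proof -
  have disj: "pnodes C \<inter> pnodes D = {}"
    using pcomponents_disjoint C by blast
  have "\<not> joined G u v" if "u \<in> pnodes s" "v \<in> pnodes t" for u v
  proof
    assume "joined G u v"
    then have "joined C u v"
      using that st joined_pcomponent[OF C(1)] by blast
    moreover have "pseudograph C"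
      using C(1) by (auto simp: pcomponents_def subgraph_def)
    ultimately have "v \<in> pnodes C"
      by (auto simp: joined_def pseudograph_def)
    then show False
      using that st disj by blast
  qed
  then show ?thesis
    using st disj unfolding compatible_def by blast
qed

section \<open>Splitting and gluing tubings along an enumeration of the components\<close>

locale pgraph_components =
  fixes G :: "('v, 'e) pgraph" and C :: "'k \<Rightarrow> ('v, 'e) pgraph"
  assumes disconnected: "\<not> connected_pgraph G"
    and bij: "bij_betw C UNIV (pcomponents G)"
begin

lemma C_in: "C i \<in> pcomponents G"
  using bij by (auto simp: bij_betw_def)

lemma C_inj: "C i = C j \<longleftrightarrow> i = j"
  using bij by (auto simp: bij_betw_def inj_on_def)

lemma C_graph: "pseudograph (C i)" "connected_pgraph (C i)"
  using C_in[of i] by (auto simp: pcomponents_def subgraph_def)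

lemma tube_C_nodes: "tube (C i) t \<Longrightarrow> pnodes t \<subseteq> pnodes (C i)"
  by (auto simp: tube_def subgraph_def)

lemma tube_C_unique:
  assumes "tube (C i) t" "tube (C j) t"
  shows "i = j"
proof -
  have "pnodes (C i) \<inter> pnodes (C j) \<noteq> {}"
    using assms[THEN tube_C_nodes] tube_nodes_nonempty[OF assms(1)] by blast
  then show ?thesis
    using pcomponents_disjoint[OF C_in C_in] C_inj by blast
qed

lemma not_tube_C: "\<not> tube (C i) (C j)"
proof
  assume t: "tube (C i) (C j)"
  then have "pnodes (C i) \<inter> pnodes (C j) \<noteq> {}"
    using tube_C_nodes tube_nodes_nonempty by blast
  then have "C i = C j"
    by (rule pcomponents_disjoint[OF C_in C_in])
  with t show False
    using not_tube_self by metis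
qed

lemma tube_cases:
  assumes "tube G t"
  obtains i where "t = C i" | i where "tube (C i) t"
proof -
  obtain D where "D \<in> pcomponents G" "subgraph t D"
    using ex_pcomponent_supergraph[of t G] assms unfolding tube_def by blast
  moreover then obtain i where "D = C i"
    using bij by (auto simp: bij_betw_def)
  ultimately show ?thesis
    using that tube_pcomponentI assms by blast
qed

lemma tubings_C: "tubings (C i) = {T. (\<forall>t\<in>T. tube (C i) t) \<and> pairwise (compatible (C i)) T}"
  using tubings_connected C_graph by blast

lemma restrict_tubing:
  assumes "T \<in> tubings G"
  shows "{t \<in> T. tube (C i) t} \<in> tubings (C i)"
  using assms compatible_pcomponent[OF C_in tube_C_nodes, of i]
  unfolding tubings_C by (simp add: tubings_def pairwise_def)

lemma missing_component:
  assumes "T \<in> tubings G"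
  shows "{i. C i \<notin> T} \<noteq> {}"
  using assms bij by (force simp: tubings_def bij_betw_def)

text \<open>By \<open>tube_cases\<close>, a tubing is determined by its traces on the components and
  by the components it omits. Recording omitted indices reverses the second inclusion.\<close>

lemma tubing_subset_iff:
  assumes "T \<in> tubings G"
  shows "T \<subseteq> S \<longleftrightarrow> (\<forall>i. {t \<in> T. tube (C i) t} \<subseteq> {t \<in> S. tube (C i) t}) \<and>
    {i. C i \<notin> S} \<subseteq> {i. C i \<notin> T}" (is "_ \<longleftrightarrow> ?R")
proof
  assume R: ?R
  show "T \<subseteq> S"
  proof
    fix t
    assume t: "t \<in> T"
    then have "tube G t"
      using assms by (simp add: tubings_def)
    then show "t \<in> S"
      using R t by (cases rule: tube_cases) blast+
  qed
qed blast

text \<open>This is surjectivity of the encoding by traces and omitted components: \<open>T\<close>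
  joins all \<open>U i\<close> and the components with index outside \<open>J\<close>. A nonempty
  \<open>J\<close> keeps \<open>T\<close> from containing every component.\<close>

lemma glue_tubings:
  assumes U: "\<And>i. U i \<in> tubings (C i)" and J: "J \<noteq> {}"
  obtains T where "T \<in> tubings G" "\<And>i. {t \<in> T. tube (C i) t} = U i" "{i. C i \<notin> T} = J"
proof -
  define T where "T = (\<Union>i. U i) \<union> C ` (- J)"
  have U_tube: "tube (C i) t" if "t \<in> U i" for i t
    using U that by (auto simp: tubings_C)
  have restr: "{t \<in> T. tube (C i) t} = U i" for i
    using U_tube tube_C_unique not_tube_C unfolding T_def by blast
  have miss: "{i. C i \<notin> T} = J"
  proof -
    have "C i \<notin> U j" for i j
      using U_tube not_tube_C by blast
    then show ?thesis
      using C_inj by (auto simp: T_def)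
  qed
  have T_cases: "\<exists>i. t = C i \<or> t \<in> U i" if "t \<in> T" for t
    using that by (auto simp: T_def)
  have nodes: "pnodes t \<subseteq> pnodes (C i)" if "t = C i \<or> t \<in> U i" for t i
    using that U_tube tube_C_nodes by blast
  have "tube G t" if "t \<in> T" for t
    using T_cases[OF that] U_tube tube_of_pcomponent[OF C_in] tube_pcomponent[OF C_in disconnected]
    by blast
  moreover have "compatible G s t" if "s \<in> T" "t \<in> T" "s \<noteq> t" for s t
  proof -
    from T_cases that obtain i j where i: "s = C i \<or> s \<in> U i" and j: "t = C j \<or> t \<in> U j"
      by blast
    show ?thesis
    proof (cases "i = j")
      case False
      then show ?thesis
        using compatible_pcomponents[OF C_in C_in] nodes i j C_inj by blast
    next
      case True
      show ?thesis
      proof (cases "s \<in> U i \<and> t \<in> U i")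
        case True
        then have "compatible (C i) s t"
          using U that by (auto simp: tubings_C pairwise_def)
        then show ?thesis
          using compatible_pcomponent[OF C_in] nodes i by blast
      next
        case False
        \<comment> \<open>One of \<open>s\<close>, \<open>t\<close> is \<open>C i\<close> itself and
          the other a tube of \<open>C i\<close>, hence a proper subgraph of it.\<close>
        then show ?thesis
          using i j \<open>i = j\<close> \<open>s \<noteq> t\<close> U_tube by (auto simp: compatible_def tube_def)
      qed
    qed
  qed
  moreover have "\<not> pcomponents G \<subseteq> T"
    using J miss C_in by blast
  ultimately have "T \<in> tubings G"
    by (auto simp: tubings_def pairwise_def)
  then show ?thesis
    using restr miss by (rule that)
qed

end

section \<open>The isomorphism of face posets\<close>

theorem theorem2:
  fixes G :: "('v, 'e) pgraph"
    and C :: "'k::finite \<Rightarrow> ('v, 'e) pgraph"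
    and P :: "'a::euclidean_space set"
    and Q :: "'k \<Rightarrow> 'b::euclidean_space set"
    and D :: "'c::euclidean_space set"
  assumes "pseudograph G"
    and "\<not> connected_pgraph G"
    and "bij_betw C UNIV (pcomponents G)"
    and "pseudograph_associahedron G P"
    and "\<And>i. pseudograph_associahedron (C i) (Q i)"
    and "(int CARD('k) - 1) simplex D"
  shows "combinatorially_isomorphic P ({x :: 'b ^ 'k. \<forall>i. x $ i \<in> Q i} \<times> D)"
proof -
  interpret pgraph_components G C
    using assms(2,3) by (rule pgraph_components.intro)
  let ?R = "{x :: 'b ^ 'k. \<forall>i. x $ i \<in> Q i}"
  obtain f where f: "bij_betw f (tubings G) (faces P)"
    and f_mono: "\<And>S T. S \<in> tubings G \<Longrightarrow> T \<in> tubings G \<Longrightarrow> T \<subseteq> S \<longleftrightarrow> f S \<subseteq> f T"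
    using assms(4) unfolding pseudograph_associahedron_def by (elim conjE exE) simp
  have "\<forall>i. \<exists>g. bij_betw g (tubings (C i)) (faces (Q i)) \<and>
      (\<forall>S\<in>tubings (C i). \<forall>T\<in>tubings (C i). T \<subseteq> S \<longleftrightarrow> g S \<subseteq> g T)"
    using assms(5) unfolding pseudograph_associahedron_def by meson
  then obtain q where q: "\<And>i. bij_betw (q i) (tubings (C i)) (faces (Q i))"
    and q_mono: "\<And>i S T. S \<in> tubings (C i) \<Longrightarrow> T \<in> tubings (C i) \<Longrightarrow> T \<subseteq> S \<longleftrightarrow> q i S \<subseteq> q i T"
    by metis
  \<comment> \<open>A simplex of dimension \<open>CARD('k) - 1\<close> has \<open>CARD('k)\<close>
    vertices, one for each component; \<open>\<kappa>\<close> below matches them.\<close>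
  obtain K where K: "\<not> affine_dependent K" "int (card K) = int CARD('k)" and D: "D = convex hull K"
    using assms(6) by (auto simp: simplex_def)
  have "finite K"
    using K(1) by (rule aff_independent_finite)
  then obtain \<kappa> :: "'k \<Rightarrow> 'c" where \<kappa>: "bij_betw \<kappa> UNIV K"
    using K(2) by (metis finite_same_card_bij finite_class.finite_UNIV of_nat_eq_iff)
  have \<kappa>_sub: "\<kappa> ` J \<subseteq> K" for J
    using \<kappa> by (auto simp: bij_betw_def)
  have \<kappa>_inj: "inj \<kappa>"
    using \<kappa> by (simp add: bij_betw_def)
  define prod where "prod E = {x :: 'b ^ 'k. \<forall>i. x $ i \<in> E i}" for E
  define restr where "restr T i = {t \<in> T. tube (C i) t}" for T i
  \<comment> \<open>The simplex factor is spanned by the vertices of the omitted components: a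
    larger tubing omits fewer and gets a smaller face, and some component is always omitted, so the
    face is nonempty.\<close>
  define h where "h T = prod (\<lambda>i. q i (restr T i)) \<times> (convex hull (\<kappa> ` {i. C i \<notin> T}))" for T
  have q_face: "q i (restr T i) face_of Q i" "q i (restr T i) \<noteq> {}" if "T \<in> tubings G" for T i
    using q[of i] restrict_tubing[OF that, of i]
    by (auto simp: bij_betw_def faces_def restr_def)
  have h_nonempty: "prod (\<lambda>i. q i (restr T i)) \<noteq> {}" "convex hull (\<kappa> ` {i. C i \<notin> T}) \<noteq> {}"
    if "T \<in> tubings G" for T
    using vec_prod_nonempty[of "\<lambda>i. q i (restr T i)"] q_face(2)[OF that] missing_component[OF that]
    by (auto simp: prod_def)
  have h_faces: "h T \<in> faces (?R \<times> D)" if T: "T \<in> tubings G" for T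
  proof -
    have "prod (\<lambda>i. q i (restr T i)) face_of ?R"
      unfolding prod_def using q_face(1)[OF T] by (rule face_of_vec_prod)
    moreover have "convex hull (\<kappa> ` {i. C i \<notin> T}) face_of D"
      using face_of_convex_hull_affine_independent[OF K(1)] \<kappa>_sub D by blast
    ultimately show ?thesis
      using h_nonempty[OF T] by (auto simp: faces_def h_def intro: face_of_Times)
  qed
  have h_mono: "T \<subseteq> S \<longleftrightarrow> h S \<subseteq> h T" if S: "S \<in> tubings G" and T: "T \<in> tubings G" for S T
  proof -
    have "h S \<subseteq> h T \<longleftrightarrow> prod (\<lambda>i. q i (restr S i)) \<subseteq> prod (\<lambda>i. q i (restr T i)) \<and>
        convex hull (\<kappa> ` {i. C i \<notin> S}) \<subseteq> convex hull (\<kappa> ` {i. C i \<notin> T})"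
      \<comment> \<open>Inclusion of products splits into inclusions of factors because both factors
        of \<open>h S\<close> are nonempty.\<close>
      using h_nonempty[OF S] unfolding h_def times_subset_iff by blast
    also have "\<dots> \<longleftrightarrow> (\<forall>i. q i (restr S i) \<subseteq> q i (restr T i)) \<and> {i. C i \<notin> S} \<subseteq> {i. C i \<notin> T}"
      using q_face(2)[OF S] convex_hull_subset_iff_affine_independent[OF K(1) \<kappa>_sub \<kappa>_sub]
      by (simp add: prod_def vec_prod_subset_iff inj_image_subset_iff[OF \<kappa>_inj])
    also have "\<dots> \<longleftrightarrow> (\<forall>i. restr T i \<subseteq> restr S i) \<and> {i. C i \<notin> S} \<subseteq> {i. C i \<notin> T}"
      using q_mono[OF restrict_tubing[OF S] restrict_tubing[OF T]] by (simp add: restr_def)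
    also have "\<dots> \<longleftrightarrow> T \<subseteq> S"
      using tubing_subset_iff[OF T] by (simp add: restr_def)
    finally show ?thesis
      by blast
  qed
  have h_surj: "F \<in> h ` tubings G" if F: "F \<in> faces (?R \<times> D)" for F
  proof -
    obtain A B where A: "A face_of ?R" and B: "B face_of D" and AB: "F = A \<times> B"
      using F by (auto simp: faces_def face_of_Times_decomp)
    have ne: "A \<noteq> {}" "B \<noteq> {}"
      using F AB by (auto simp: faces_def)
    define E where "E i = (\<lambda>x. x $ i) ` A" for i
    have A_eq: "A = prod E" and E: "\<And>i. E i \<in> faces (Q i)"
      using face_of_vec_prod_imp_prod[OF A] ne by (auto simp: prod_def E_def faces_def)
    then have "\<forall>i. \<exists>U. U \<in> tubings (C i) \<and> q i U = E i"
      using q by (metis bij_betw_def imageE)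
    then obtain U where U: "\<And>i. U i \<in> tubings (C i)" "\<And>i. q i (U i) = E i"
      by metis
    obtain L where L: "L \<subseteq> K" "B = convex hull L"
      using B face_of_convex_hull_affine_independent[OF K(1)] D by blast
    define J where "J = \<kappa> -` L"
    have L_eq: "L = \<kappa> ` J"
      using L(1) \<kappa> by (auto simp: J_def bij_betw_def)
    \<comment> \<open>An empty \<open>J\<close> would make \<open>B\<close> empty; this is where
      leaving out the empty face matches the demand that a tubing omit a component.\<close>
    have "J \<noteq> {}"
      using ne(2) L(2) L_eq by auto
    with U(1) obtain T where T: "T \<in> tubings G" "\<And>i. {t \<in> T. tube (C i) t} = U i" "{i. C i \<notin> T} = J"
      by (rule glue_tubings) auto
    have "h T = F"
      using T U(2) A_eq L L_eq AB by (simp add: h_def restr_def)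
    with T(1) show ?thesis
      by blast
  qed
  have h: "bij_betw h (tubings G) (faces (?R \<times> D))"
    unfolding bij_betw_def
  proof
    show "inj_on h (tubings G)"
      by (rule inj_onI) (metis h_mono order_antisym order_refl)
    show "h ` tubings G = faces (?R \<times> D)"
      using h_faces h_surj by blast
  qed
  let ?g = "the_inv_into (tubings G) f"
  have g: "bij_betw ?g (faces P) (tubings G)"
    using f by (rule bij_betw_the_inv_into)
  have fg: "f (?g E) = E" and g_in: "?g E \<in> tubings G" if "E \<in> faces P" for E
    using that f g f_the_inv_into_f_bij_betw[OF f] by (auto simp: bij_betw_def)
  \<comment> \<open>Both \<open>f\<close> and \<open>h\<close> reverse inclusion, so
    \<open>h\<close> after the inverse of \<open>f\<close> preserves it.\<close>
  have "bij_betw (h \<circ> ?g) (faces P) (faces (?R \<times> D))"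
    using g h by (rule bij_betw_trans)
  moreover have "E \<subseteq> F \<longleftrightarrow> (h \<circ> ?g) E \<subseteq> (h \<circ> ?g) F" if "E \<in> faces P" "F \<in> faces P" for E F
    using that fg g_in f_mono[of "?g E" "?g F"] h_mono[of "?g E" "?g F"] by simp
  ultimately show ?thesis
    unfolding combinatorially_isomorphic_def by blast
qed

end
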